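(* If $k$ is an even positive integer whose prime decomposition contains a prime $p \equiv 3 \pmod 4$ raised to an odd power, then there does not exist a cyclic $S(2,k,2k(k-1)+k)$.
   Context: A Steiner 2-design of order $v$ and block-size $k$, denoted $S(2,k,v)$, consists of a set of $k$-subsets (called blocks) of a $v$-set (whose elements are called points) such that every pair of distinct points occurs in a unique block. An $S(2,k,v)$ is cyclic if there is a cyclic permutation of the $v$ points (a single $v$-cycle) that maps every block to a block. *)

theory Defs
  imports
    "HOL-Combinatorics.Orbits"
    "HOL-Computational_Algebra.Primes"
begin

definition steiner_2_design :: "nat \<Rightarrow> nat \<Rightarrow> 'a set \<Rightarrow> 'a set set \<Rightarrow> bool" where
  "steiner_2_design k v V \<B> \<longleftrightarrow>
     finite V \<and> card V = v \<and>
     (\<forall>B\<in>\<B>. B \<subseteq> V \<and> card B = k) \<and>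
     (\<forall>x\<in>V. \<forall>y\<in>V. x \<noteq> y \<longrightarrow> (\<exists>!B. B \<in> \<B> \<and> x \<in> B \<and> y \<in> B))"

(* A permutation of V with cyclic_on \<pi> V has V as a single orbit, so it is one cycle of
   length card V. *)
definition cyclic_steiner_2_design :: "nat \<Rightarrow> nat \<Rightarrow> 'a set \<Rightarrow> 'a set set \<Rightarrow> bool" where
  "cyclic_steiner_2_design k v V \<B> \<longleftrightarrow>
     steiner_2_design k v V \<B> \<and>
     (\<exists>\<pi>. \<pi> permutes V \<and> cyclic_on \<pi> V \<and> (\<forall>B\<in>\<B>. \<pi> ` B \<in> \<B>))"

end

theory Submission
  imports Defs "HOL-Number_Theory.Residues"
begin

text \<open>
  Let \<open>v = 2 k (k - 1) + k = k (2 k - 1)\<close>, which is even, and suppose that the \<open>v\<close>-cycle \<open>\<pi>\<close>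
  acts on an \<open>S(2,k,v)\<close>. Colour the points with signs \<open>\<epsilon> x = \<plusminus>1\<close> alternating along the cycle,
  and for a block \<open>B\<close> let \<open>s B\<close> be the sum of \<open>\<epsilon>\<close> over \<open>B\<close>. This is the quadratic character of
  \<open>\<int>/v\<close> evaluated at \<open>B\<close>; the signs sum to zero over all points.

  Every pair of points lies in exactly one block, so a double count gives \<open>4 k\<^sup>2 - 1\<close> blocks and
  \<open>(\<Sum>B. (s B)\<^sup>2) = 2 k v\<close>. As \<open>s (\<pi> ` B) = - s B\<close>, the value \<open>(s B)\<^sup>2\<close> is constant on the orbits
  of \<open>\<pi>\<close> on blocks. A block fixed by some \<open>\<pi> ^^ m\<close> with \<open>0 < m < v\<close> must be an orbit of
  \<open>\<pi> ^^ (2 k - 1)\<close> (lemma \<open>short_block\<close>). Such short blocks are therefore disjoint, so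
  there are at most \<open>2 k - 1\<close> of them, and they have \<open>s B = 0\<close> because \<open>2 k - 1\<close> is odd. The
  remaining blocks number between \<open>2 v\<close> and \<open>3 v - 1\<close> and fall into orbits of length \<open>v\<close>, so there are
  exactly two such orbits (lemma \<open>sum_over_free_orbits\<close>). Writing \<open>a\<close> and \<open>b\<close> for the values of \<open>s\<close> at representatives, one gets
  \<open>v (a\<^sup>2 + b\<^sup>2) = 2 k v\<close>, so \<open>2 k\<close> is a sum of two squares. A prime congruent to \<open>3\<close> modulo \<open>4\<close>
  divides a positive sum of two squares to an even power, which contradicts the hypothesis on \<open>k\<close>.
\<close>

section \<open>Sums of two squares\<close>

lemma prime_3_mod_4_dvd_sum_two_squares:
  fixes a b p :: nat
  assumes p: "prime p" "p mod 4 = 3" and dvd: "p dvd a\<^sup>2 + b\<^sup>2"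
  shows "p dvd a"
proof (rule ccontr)
  assume na: "\<not> p dvd a"
  have nb: "\<not> p dvd b"
  proof
    assume "p dvd b"
    then have "p dvd b\<^sup>2" by (simp add: power2_eq_square)
    with dvd have "p dvd a\<^sup>2" using dvd_add_left_iff by blast
    with na p(1) show False using prime_dvd_power by blast
  qed
  \<comment> \<open>Raise \<open>a\<^sup>2 = -b\<^sup>2\<close> modulo \<open>p\<close> to the odd power \<open>(p - 1) / 2\<close>; by Fermat the left side becomes \<open>1\<close> and the right side \<open>-1\<close>.\<close>
  define m where "m = p div 4"
  have pm: "p - 1 = 2 * (2 * m + 1)" using p(2) unfolding m_def by presburger
  have "[int a ^ 2 = - (int b ^ 2)] (mod int p)"
    using dvd by (metis cong_iff_dvd_diff diff_minus_eq_add
        int_dvd_int_iff of_nat_add of_nat_power)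
  then have "[(int a ^ 2) ^ (2 * m + 1) = (- (int b ^ 2)) ^ (2 * m + 1)] (mod int p)"
    by (rule cong_pow)
  then have "[int a ^ (p - 1) = - (int b ^ (p - 1))] (mod int p)"
    by (simp only: pm power_mult power_minus_odd even_add even_mult_iff odd_one dvd_refl) simp
  moreover have "[int a ^ (p - 1) = 1] (mod int p)" "[int b ^ (p - 1) = 1] (mod int p)"
    using fermat_theorem[OF p(1) na] fermat_theorem[OF p(1) nb]
    by (metis cong_int_iff of_nat_1 of_nat_power)+
  ultimately have "[1 = - 1] (mod int p)"
    by (metis cong_minus_minus_iff cong_sym cong_trans)
  then have "int p dvd 2" by (simp add: cong_iff_dvd_diff)
  then have "p \<le> 2" using zdvd_imp_le by fastforce
  with p(2) prime_ge_2_nat[OF p(1)] show False by simp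
qed

lemma even_multiplicity_sum_two_squares:
  fixes a b p :: nat
  assumes p: "prime p" "p mod 4 = 3" and "a\<^sup>2 + b\<^sup>2 \<noteq> 0"
  shows "even (multiplicity p (a\<^sup>2 + b\<^sup>2))"
  using assms(3)
proof (induction "a + b" arbitrary: a b rule: less_induct)
  case less
  show ?case
  proof (cases "p dvd a\<^sup>2 + b\<^sup>2")
    case True
    then have "p dvd a" "p dvd b"
      using prime_3_mod_4_dvd_sum_two_squares[OF p, of a b]
        prime_3_mod_4_dvd_sum_two_squares[OF p, of b a] by (simp_all add: add.commute)
    then obtain c d where cd: "a = p * c" "b = p * d" unfolding dvd_def by blast
    have p2: "p \<ge> 2" using p(1) by (rule prime_ge_2_nat)
    have eq: "a\<^sup>2 + b\<^sup>2 = p * (p * (c\<^sup>2 + d\<^sup>2))"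
      unfolding cd by (simp add: power2_eq_square algebra_simps)
    with less.prems have nz: "c\<^sup>2 + d\<^sup>2 \<noteq> 0" by auto
    then have "c + d > 0" by auto
    moreover have "a + b = p * (c + d)" unfolding cd by (simp add: algebra_simps)
    ultimately have "c + d < a + b" using p2 by simp
    then have "even (multiplicity p (c\<^sup>2 + d\<^sup>2))" using less.hyps nz by blast
    moreover have "multiplicity p (a\<^sup>2 + b\<^sup>2) = Suc (Suc (multiplicity p (c\<^sup>2 + d\<^sup>2)))"
    proof -
      have mult: "multiplicity p (p * n) = Suc (multiplicity p n)" if "n > 0" for n
        using that p2 by (intro multiplicity_times_same) auto
      have "c\<^sup>2 + d\<^sup>2 > 0" "p * (c\<^sup>2 + d\<^sup>2) > 0" using nz p2 by auto
      then show ?thesis unfolding eq by (simp only: mult)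
    qed
    ultimately show ?thesis by simp
  qed (simp add: not_dvd_imp_multiplicity_0)
qed

section \<open>Free orbits and closed sets of exponents\<close>

lemma funpow_image:
  fixes f :: "'a \<Rightarrow> 'a"
  shows "((`) f ^^ n) B = (f ^^ n) ` B"
  by (induction n) (simp_all add: image_comp)

text \<open>
  A finite set on which a map of period \<open>v\<close> acts without shorter periods splits into orbits of
  length \<open>v\<close>. The list \<open>xs\<close> consists of representatives of these orbits, and \<open>w\<close> is a weight
  that is constant on them.
\<close>
lemma sum_over_free_orbits:
  fixes w :: "'b \<Rightarrow> int"
  assumes "finite G" "v > 0"
    and "\<And>X. X \<in> G \<Longrightarrow> T X \<in> G"
    and "\<And>X. X \<in> G \<Longrightarrow> (T ^^ v) X = X"
    and "\<And>X m. X \<in> G \<Longrightarrow> 0 < m \<Longrightarrow> m < v \<Longrightarrow> (T ^^ m) X \<noteq> X"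
    and "\<And>X. X \<in> G \<Longrightarrow> w (T X) = w X"
  shows "\<exists>xs. set xs \<subseteq> G \<and> card G = v * length xs \<and> sum w G = int v * sum_list (map w xs)"
  using assms(1,3-)
proof (induction "card G" arbitrary: G rule: less_induct)
  case less
  note G = less.prems
  show ?case
  proof (cases "G = {}")
    case True
    then show ?thesis by (intro exI[of _ "[]"]) auto
  next
    case False
    then obtain X where X: "X \<in> G" by auto
    define Orb where "Orb = (\<lambda>i. (T ^^ i) X) ` {..<v}"
    have TG: "(T ^^ i) X \<in> G" for i by (induction i) (use X G(2) in auto)
    have OG: "Orb \<subseteq> G" unfolding Orb_def using TG by auto
    have inj: "(T ^^ i) X \<noteq> (T ^^ j) X" if "i < j" "j < v" for i j
    proof -
      have "(T ^^ j) X = (T ^^ (j - i)) ((T ^^ i) X)"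
        using that by (simp add: funpow_add[symmetric, THEN fun_cong, unfolded o_def])
      then show ?thesis using G(4)[OF TG[of i], of "j - i"] that by (simp add: less_imp_diff_less)
    qed
    have inj': "inj_on (\<lambda>i. (T ^^ i) X) {..<v}"
      by (rule linorder_inj_onI) (use inj in auto)
    then have cO: "card Orb = v" unfolding Orb_def by (simp add: card_image)
    have "w ((T ^^ i) X) = w X" for i
      by (induction i) (use TG G(5) in auto)
    then have sO: "sum w Orb = int v * w X"
      unfolding Orb_def using inj' by (simp add: sum.reindex)
    have Ocl: "T Y \<in> Orb" if "Y \<in> Orb" for Y
    proof -
      obtain i where i: "i < v" "Y = (T ^^ i) X" using \<open>Y \<in> Orb\<close> unfolding Orb_def by auto
      then have TY: "T Y = (T ^^ Suc i) X" by simp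
      show ?thesis
      proof (cases "Suc i = v")
        case True
        then have "T Y = (T ^^ 0) X" using TY G(3)[OF X] by simp
        then show ?thesis unfolding Orb_def using assms(2) by blast
      next
        case False
        then show ?thesis unfolding Orb_def using TY i(1) by (metis Suc_lessI imageI lessThan_iff)
      qed
    qed
    have Ocl': "(T ^^ n) Y \<in> Orb" if "Y \<in> Orb" for n Y
      by (induction n) (use that Ocl in auto)
    define H where "H = G - Orb"
    have HT: "T Y \<in> H" if "Y \<in> H" for Y
    proof -
      have Y: "Y \<in> G" "Y \<notin> Orb" using that unfolding H_def by auto
      have "(T ^^ (v - 1)) (T Y) = (T ^^ v) Y"
        using assms(2) by (cases v) (auto simp: funpow_swap1)
      then have "T Y \<notin> Orb" using Ocl'[of "T Y" "v - 1"] Y G(3) by auto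
      then show ?thesis unfolding H_def using Y G(2) by auto
    qed
    have HG: "H \<subseteq> G" and finO: "finite Orb" unfolding H_def Orb_def by auto
    have cH: "card G = v + card H"
      unfolding H_def using OG G(1) cO finO by (metis card_Diff_subset card_mono le_add_diff_inverse)
    have "\<exists>xs. set xs \<subseteq> H \<and> card H = v * length xs \<and> sum w H = int v * sum_list (map w xs)"
    proof (rule less.hyps)
      show "card H < card G" using cH assms(2) by simp
      show "finite H" using G(1) HG finite_subset by auto
      show "\<And>X. X \<in> H \<Longrightarrow> T X \<in> H" using HT by auto
    qed (use HG G in blast)+
    then obtain xs where xs: "set xs \<subseteq> H" "card H = v * length xs"
      "sum w H = int v * sum_list (map w xs)" by auto
    have "sum w G = sum w Orb + sum w H"
      unfolding H_def using OG G(1) by (simp add: sum.subset_diff add.commute)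
    then show ?thesis using xs cH sO HG X
      by (intro exI[of _ "X # xs"]) (auto simp: algebra_simps)
  qed
qed

text \<open>Applied to the set of exponents \<open>j\<close> for which \<open>\<pi> ^^ j\<close> stabilises a given block.\<close>
lemma closed_nat_set_eq_multiples:
  fixes S :: "nat set"
  assumes "n \<in> S" "n > 0"
    and add: "\<And>i j. i \<in> S \<Longrightarrow> j \<in> S \<Longrightarrow> i + j \<in> S"
    and diff: "\<And>i j. i \<in> S \<Longrightarrow> j \<in> S \<Longrightarrow> i \<le> j \<Longrightarrow> j - i \<in> S"
  obtains d where "d > 0" "\<And>i. i \<in> S \<longleftrightarrow> d dvd i"
proof -
  define d where "d = (LEAST i. i \<in> S \<and> i > 0)"
  have d: "d \<in> S" "d > 0"
    using LeastI[of "\<lambda>i. i \<in> S \<and> i > 0" n] assms(1,2) unfolding d_def by auto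
  have least: "d \<le> i" if "i \<in> S" "i > 0" for i
    unfolding d_def using that by (intro Least_le) auto
  have mult: "d * j \<in> S" for j
  proof (induction j)
    case 0
    show ?case using diff[OF d(1) d(1)] by simp
  next
    case (Suc j)
    then show ?case using add[OF d(1)] by simp
  qed
  have "i \<in> S \<longleftrightarrow> d dvd i" for i
  proof
    assume "i \<in> S"
    then have "i - d * (i div d) \<in> S" by (intro diff mult) auto
    then have "i mod d \<in> S" by (simp add: minus_mult_div_eq_mod)
    then show "d dvd i" using least[of "i mod d"] d(2)
      by (metis dvd_eq_mod_eq_0 mod_less_divisor not_gr_zero not_le)
  qed (auto simp: mult)
  with d(2) that show thesis by blast
qed

lemma card_multiples_less:
  fixes d c :: nat
  assumes "d > 0"
  shows "card {j. j < d * c \<and> d dvd j} = c"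
proof -
  have "{j. j < d * c \<and> d dvd j} = (\<lambda>i. d * i) ` {..<c}"
    using assms by (auto)
  moreover have "inj_on (\<lambda>i. d * i) {..<c}" using assms by (auto simp: inj_on_def)
  ultimately show ?thesis by (simp add: card_image)
qed

section \<open>Double counting in a Steiner 2-design\<close>

lemma steiner_finite_blocks:
  assumes "steiner_2_design k v V \<B>"
  shows "finite \<B>"
proof (rule finite_subset)
  show "\<B> \<subseteq> Pow V" "finite (Pow V)" using assms unfolding steiner_2_design_def by auto
qed

lemma steiner_sum_pairs:
  fixes f :: "'a \<Rightarrow> 'a \<Rightarrow> 'b :: comm_monoid_add"
  assumes D: "steiner_2_design k v V \<B>"
  shows "(\<Sum>B\<in>\<B>. \<Sum>x\<in>B. \<Sum>y\<in>B - {x}. f x y) = (\<Sum>x\<in>V. \<Sum>y\<in>V - {x}. f x y)"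
proof -
  have fV: "finite V" and sub: "\<And>B. B \<in> \<B> \<Longrightarrow> B \<subseteq> V"
    and uniq: "\<And>x y. x \<in> V \<Longrightarrow> y \<in> V \<Longrightarrow> x \<noteq> y \<Longrightarrow> \<exists>!B. B \<in> \<B> \<and> x \<in> B \<and> y \<in> B"
    using D unfolding steiner_2_design_def by auto
  have fB: "finite \<B>" using D by (rule steiner_finite_blocks)
  define g where "g B x y = (if x \<in> B \<and> y \<in> B then f x y else 0)" for B x y
  have "(\<Sum>x\<in>B. \<Sum>y\<in>B - {x}. f x y) = (\<Sum>x\<in>V. \<Sum>y\<in>V - {x}. g B x y)" if "B \<in> \<B>" for B
  proof (rule sum.mono_neutral_cong_left)
    show "\<forall>x\<in>V - B. (\<Sum>y\<in>V - {x}. g B x y) = 0" by (auto simp: g_def)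
    fix x assume x: "x \<in> B"
    show "(\<Sum>y\<in>B - {x}. f x y) = (\<Sum>y\<in>V - {x}. g B x y)"
      by (rule sum.mono_neutral_cong_left) (use fV sub[OF that] x in \<open>auto simp: g_def\<close>)
  qed (use fV sub[OF that] in auto)
  then have "(\<Sum>B\<in>\<B>. \<Sum>x\<in>B. \<Sum>y\<in>B - {x}. f x y) = (\<Sum>B\<in>\<B>. \<Sum>x\<in>V. \<Sum>y\<in>V - {x}. g B x y)"
    by simp
  also have "\<dots> = (\<Sum>x\<in>V. \<Sum>B\<in>\<B>. \<Sum>y\<in>V - {x}. g B x y)" by (rule sum.swap)
  also have "\<dots> = (\<Sum>x\<in>V. \<Sum>y\<in>V - {x}. \<Sum>B\<in>\<B>. g B x y)"
    by (intro sum.cong refl sum.swap)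
  also have "\<dots> = (\<Sum>x\<in>V. \<Sum>y\<in>V - {x}. f x y)"
  proof (intro sum.cong refl)
    fix x y assume xy: "x \<in> V" "y \<in> V - {x}"
    then obtain B0 where B0: "B0 \<in> \<B>" "\<And>B. B \<in> \<B> \<Longrightarrow> x \<in> B \<and> y \<in> B \<longleftrightarrow> B = B0"
      using uniq[of x y] by blast
    have "(\<Sum>B\<in>\<B>. g B x y) = (\<Sum>B\<in>\<B>. if B = B0 then f x y else 0)"
      unfolding g_def using B0(2) by (intro sum.cong) auto
    then show "(\<Sum>B\<in>\<B>. g B x y) = f x y" using B0(1) fB by simp
  qed
  finally show ?thesis .
qed

lemma steiner_card_blocks:
  assumes D: "steiner_2_design k v V \<B>"
  shows "card \<B> * (k * (k - 1)) = v * (v - 1)"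
proof -
  have count: "(\<Sum>x\<in>A. \<Sum>y\<in>A - {x}. 1 :: nat) = card A * (card A - 1)" for A :: "'a set"
    by simp
  have "(\<Sum>B\<in>\<B>. card B * (card B - 1)) = card V * (card V - 1)"
    using steiner_sum_pairs[OF D, of "\<lambda>_ _. 1 :: nat"] unfolding count .
  moreover have "card V = v" "\<forall>B\<in>\<B>. card B = k"
    using D unfolding steiner_2_design_def by auto
  ultimately show ?thesis by simp
qed

lemma square_sum_signs:
  fixes \<epsilon> :: "'a \<Rightarrow> int"
  assumes "finite A" and sq: "\<And>x. x \<in> A \<Longrightarrow> \<epsilon> x * \<epsilon> x = 1"
  shows "(sum \<epsilon> A)\<^sup>2 = int (card A) + (\<Sum>x\<in>A. \<Sum>y\<in>A - {x}. \<epsilon> x * \<epsilon> y)"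
proof -
  have "(sum \<epsilon> A)\<^sup>2 = (\<Sum>x\<in>A. \<Sum>y\<in>A. \<epsilon> x * \<epsilon> y)"
    by (simp add: power2_eq_square sum_product)
  also have "\<dots> = (\<Sum>x\<in>A. 1 + (\<Sum>y\<in>A - {x}. \<epsilon> x * \<epsilon> y))"
    using assms by (intro sum.cong refl) (simp add: sum.remove)
  finally show ?thesis by (simp add: sum.distrib)
qed

lemma steiner_sum_square_signs:
  fixes \<epsilon> :: "'a \<Rightarrow> int"
  assumes D: "steiner_2_design k v V \<B>" and sq: "\<And>x. x \<in> V \<Longrightarrow> \<epsilon> x * \<epsilon> x = 1"
    and zero: "sum \<epsilon> V = 0"
  shows "(\<Sum>B\<in>\<B>. (sum \<epsilon> B)\<^sup>2) = int (card \<B>) * int k - int v"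
proof -
  have fV: "finite V" "card V = v" and sub: "\<And>B. B \<in> \<B> \<Longrightarrow> B \<subseteq> V \<and> card B = k"
    using D unfolding steiner_2_design_def by auto
  have "(sum \<epsilon> B)\<^sup>2 = int k + (\<Sum>x\<in>B. \<Sum>y\<in>B - {x}. \<epsilon> x * \<epsilon> y)" if "B \<in> \<B>" for B
    using square_sum_signs[of B \<epsilon>] sub[OF that] fV sq by (metis finite_subset subsetD)
  then have "(\<Sum>B\<in>\<B>. (sum \<epsilon> B)\<^sup>2)
      = int (card \<B>) * int k + (\<Sum>B\<in>\<B>. \<Sum>x\<in>B. \<Sum>y\<in>B - {x}. \<epsilon> x * \<epsilon> y)"
    by (simp add: sum.distrib)
  also have "(\<Sum>B\<in>\<B>. \<Sum>x\<in>B. \<Sum>y\<in>B - {x}. \<epsilon> x * \<epsilon> y) = (\<Sum>x\<in>V. \<Sum>y\<in>V - {x}. \<epsilon> x * \<epsilon> y)"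
    using D by (rule steiner_sum_pairs)
  also have "\<dots> = - int v" using square_sum_signs[of V \<epsilon>] fV sq zero by simp
  finally show ?thesis by simp
qed

section \<open>Cyclic designs\<close>

text \<open>A Steiner 2-design together with a chosen full cycle on its points that preserves blocks.\<close>
locale cyclic_design =
  fixes k v :: nat and V :: "'a set" and \<B> :: "'a set set" and \<pi> :: "'a \<Rightarrow> 'a"
  assumes design: "steiner_2_design k v V \<B>"
    and permutes: "\<pi> permutes V"
    and cyclic: "cyclic_on \<pi> V"
    and block_closed: "B \<in> \<B> \<Longrightarrow> \<pi> ` B \<in> \<B>"
begin

lemma finite_V: "finite V" and card_V: "card V = v"
  and block_subset: "B \<in> \<B> \<Longrightarrow> B \<subseteq> V" and block_card: "B \<in> \<B> \<Longrightarrow> card B = k"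
  using design unfolding steiner_2_design_def by auto

lemma block_unique:
  assumes "B \<in> \<B>" "C \<in> \<B>" "x \<in> B" "y \<in> B" "x \<in> C" "y \<in> C" "x \<noteq> y"
  shows "B = C"
proof -
  have "x \<in> V" "y \<in> V" using assms block_subset by auto
  then have "\<exists>!B. B \<in> \<B> \<and> x \<in> B \<and> y \<in> B"
    using assms(7) design unfolding steiner_2_design_def by auto
  then show ?thesis using assms by auto
qed

lemma v_pos: "v > 0"
  using cyclic finite_V card_V unfolding cyclic_on_def by (metis card_gt_0_iff empty_iff)

lemma funpow_in_V: "x \<in> V \<Longrightarrow> (\<pi> ^^ n) x \<in> V"
  using cyclic cyclic_on_funpow_in by metis

lemma block_funpow: "B \<in> \<B> \<Longrightarrow> (\<pi> ^^ n) ` B \<in> \<B>"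
proof (induction n)
  case (Suc n)
  then show ?case using block_closed[of "(\<pi> ^^ n) ` B"] by (simp add: image_comp)
qed simp

lemma inj_funpow: "inj (\<pi> ^^ n)"
  using permutes by (intro inj_fn permutes_inj)

lemma orbit_eq_V: "x \<in> V \<Longrightarrow> orbit \<pi> x = V"
  using cyclic orbit_cyclic_eq3 by metis

lemma funpow_dist1_eq_v:
  assumes "x \<in> V"
  shows "funpow_dist1 \<pi> x x = v"
proof -
  have self: "x \<in> orbit \<pi> x" using assms orbit_eq_V by auto
  have "card (orbit \<pi> x) = funpow_dist1 \<pi> x x"
    using orbit_conv_funpow_dist1[OF self] inj_on_funpow_dist1[OF self]
    by (metis card_atLeastLessThan card_image diff_zero)
  then show ?thesis using assms orbit_eq_V card_V by simp
qed

lemma funpow_v: "x \<in> V \<Longrightarrow> (\<pi> ^^ v) x = x"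
  using funpow_dist1_prop[of x \<pi> x] orbit_eq_V funpow_dist1_eq_v by metis

lemma funpow_fixed_iff:
  assumes "x \<in> V"
  shows "(\<pi> ^^ n) x = x \<longleftrightarrow> v dvd n"
proof -
  have "(\<pi> ^^ n) x = (\<pi> ^^ (n mod v)) x"
    using funpow_mod_eq[OF funpow_v[OF assms]] by simp
  moreover have "(\<pi> ^^ (n mod v)) x \<noteq> x" if "n mod v > 0"
    using funpow_dist1_least[OF that, of \<pi> x x] funpow_dist1_eq_v[OF assms] v_pos by simp
  ultimately show ?thesis by (cases "n mod v = 0") auto
qed

lemma funpow_eq_dvd:
  assumes "x \<in> V" "i \<le> j" "(\<pi> ^^ i) x = (\<pi> ^^ j) x"
  shows "v dvd j - i"
proof -
  have "(\<pi> ^^ j) x = (\<pi> ^^ (j - i)) ((\<pi> ^^ i) x)"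
    using assms(2) by (simp add: funpow_add[symmetric, THEN fun_cong, unfolded o_def])
  then show ?thesis
    using assms(3) funpow_fixed_iff[OF funpow_in_V[OF assms(1)]] by metis
qed

lemma inj_on_funpow_less: "x \<in> V \<Longrightarrow> inj_on (\<lambda>i. (\<pi> ^^ i) x) {..<v}"
proof (rule linorder_inj_onI)
  fix i j assume "x \<in> V" "i < j" "i \<in> {..<v}" "j \<in> {..<v}"
  then show "(\<pi> ^^ i) x \<noteq> (\<pi> ^^ j) x"
    using funpow_eq_dvd[of x i j] nat_dvd_not_less[of "j - i" v] by auto
qed auto

lemma funpow_reaches:
  assumes "x \<in> V" "y \<in> V"
  shows "\<exists>j<v. (\<pi> ^^ j) x = y"
proof -
  have "(\<lambda>i. (\<pi> ^^ i) x) ` {..<v} = V"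
    using inj_on_funpow_less[OF assms(1)] funpow_in_V[OF assms(1)] finite_V card_V
    by (intro card_subset_eq) (auto simp: card_image)
  then show ?thesis using assms(2) by blast
qed

text \<open>
  The quadratic character on the points. It is well defined because the cycle has even length, so
  the parity of the number of steps from a base point \<open>z\<close> to \<open>x\<close> depends on \<open>x\<close> only.
\<close>
lemma alternating_signs:
  assumes "even v"
  obtains \<epsilon> :: "'a \<Rightarrow> int" where "\<And>x. \<epsilon> x * \<epsilon> x = 1" "\<And>x. x \<in> V \<Longrightarrow> \<epsilon> (\<pi> x) = - \<epsilon> x"
proof -
  obtain z where z: "z \<in> V" using cyclic unfolding cyclic_on_def by auto
  define \<epsilon> :: "'a \<Rightarrow> int" where "\<epsilon> x = (-1) ^ (SOME j. (\<pi> ^^ j) z = x)" for x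
  have val: "\<epsilon> x = (-1) ^ j" if "(\<pi> ^^ j) z = x" for x j
  proof -
    define i where "i = (SOME j. (\<pi> ^^ j) z = x)"
    have "(\<pi> ^^ i) z = x" unfolding i_def using that by (rule someI)
    then have "i \<le> j \<Longrightarrow> v dvd j - i" "j \<le> i \<Longrightarrow> v dvd i - j"
      using funpow_eq_dvd[OF z] that by auto
    then have "i \<le> j \<Longrightarrow> even (j - i)" "j \<le> i \<Longrightarrow> even (i - j)"
      using assms dvd_trans by blast+
    then have "even i \<longleftrightarrow> even j" by (cases "i \<le> j") simp_all
    then show ?thesis unfolding \<epsilon>_def i_def[symmetric] by (simp add: uminus_power_if)
  qed
  have "\<epsilon> (\<pi> x) = - \<epsilon> x" if "x \<in> V" for x
  proof -
    obtain j where j: "(\<pi> ^^ j) z = x" using funpow_reaches[OF z \<open>x \<in> V\<close>] by auto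
    then have "(\<pi> ^^ Suc j) z = \<pi> x" by simp
    then show ?thesis using val[OF j] val[of "Suc j" "\<pi> x"] by simp
  qed
  moreover have "\<epsilon> x * \<epsilon> x = 1" for x
    unfolding \<epsilon>_def by (simp add: uminus_power_if)
  ultimately show thesis using that by blast
qed

lemma sum_signs_image:
  fixes \<epsilon> :: "'a \<Rightarrow> int"
  assumes "\<And>x. x \<in> V \<Longrightarrow> \<epsilon> (\<pi> x) = - \<epsilon> x" "B \<subseteq> V"
  shows "sum \<epsilon> ((\<pi> ^^ n) ` B) = (-1) ^ n * sum \<epsilon> B"
proof -
  have "\<epsilon> ((\<pi> ^^ n) x) = (-1) ^ n * \<epsilon> x" if "x \<in> V" for x
    by (induction n) (use assms(1) funpow_in_V that in auto)
  then have "(\<Sum>x\<in>B. \<epsilon> ((\<pi> ^^ n) x)) = (-1) ^ n * sum \<epsilon> B"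
    using assms(2) by (auto simp: sum_distrib_left intro!: sum.cong)
  then show ?thesis by (simp add: sum.reindex inj_on_subset[OF inj_funpow])
qed

text \<open>
  A block with a nontrivial stabiliser is an orbit of that stabiliser: if \<open>\<pi> ^^ m\<close> fixes \<open>B\<close>, then
  for \<open>x\<close> and \<open>(\<pi> ^^ j) x\<close> in \<open>B\<close> the blocks \<open>B\<close> and \<open>(\<pi> ^^ j) ` B\<close> share the two points
  \<open>(\<pi> ^^ j) x\<close> and \<open>(\<pi> ^^ (j + m)) x\<close>, and so coincide. The stabiliser therefore has order \<open>k\<close>.
\<close>
lemma short_block:
  assumes B: "B \<in> \<B>" and x: "x \<in> B" and m: "0 < m" "m < v" and fixed: "(\<pi> ^^ m) ` B = B"
  shows "k dvd v" "(\<pi> ^^ (v div k)) ` B = B" "B = {(\<pi> ^^ j) x | j. (v div k) dvd j}"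
proof -
  define S where "S = {j. (\<pi> ^^ j) ` B = B}"
  have xV: "x \<in> V" using B x block_subset by auto
  have mem: "(\<pi> ^^ j) x \<in> B \<longleftrightarrow> j \<in> S" for j
  proof
    assume jx: "(\<pi> ^^ j) x \<in> B"
    let ?y = "(\<pi> ^^ j) x"
    have comm: "(\<pi> ^^ m) ?y = (\<pi> ^^ j) ((\<pi> ^^ m) x)"
      by (metis add.commute comp_apply funpow_add)
    have "(\<pi> ^^ m) ?y \<noteq> ?y"
      using funpow_fixed_iff[OF funpow_in_V[OF xV]] m nat_dvd_not_less by metis
    moreover have "(\<pi> ^^ m) ?y \<in> B" "(\<pi> ^^ m) x \<in> B" using jx x fixed by auto
    moreover have "(\<pi> ^^ j) ` B \<in> \<B>" using B by (rule block_funpow)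
    ultimately have "(\<pi> ^^ j) ` B = B"
      using block_unique[of "(\<pi> ^^ j) ` B" B ?y "(\<pi> ^^ m) ?y"] B jx x unfolding comm by auto
    then show "j \<in> S" unfolding S_def by simp
  qed (use x in \<open>auto simp: S_def\<close>)
  have vS: "v \<in> S" using mem[of v] funpow_v[OF xV] x by simp
  have add: "i + j \<in> S" if "i \<in> S" "j \<in> S" for i j
    using that unfolding S_def by (simp only: funpow_add image_comp[symmetric] mem_Collect_eq)
  have diff: "j - i \<in> S" if "i \<in> S" "j \<in> S" "i \<le> j" for i j
  proof -
    have "(\<pi> ^^ i) ` ((\<pi> ^^ (j - i)) ` B) = (\<pi> ^^ j) ` B"
      using that(3) by (simp add: image_comp funpow_add[symmetric])
    also have "\<dots> = (\<pi> ^^ i) ` B" using that unfolding S_def by simp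
    finally show ?thesis unfolding S_def using inj_image_eq_iff[OF inj_funpow] by auto
  qed
  obtain d where d: "d > 0" "\<And>i. i \<in> S \<longleftrightarrow> d dvd i"
    using closed_nat_set_eq_multiples[OF vS v_pos add diff] by blast
  obtain c where c: "v = d * c" using d(2) vS by (auto)
  have reach: "\<exists>j<v. (\<pi> ^^ j) x = y" if "y \<in> B" for y
    using funpow_reaches[OF xV] B that block_subset by auto
  have "B = (\<lambda>j. (\<pi> ^^ j) x) ` {j. j < v \<and> d dvd j}"
  proof (intro equalityI subsetI)
    fix y assume "y \<in> B"
    then obtain j where "j < v" "(\<pi> ^^ j) x = y" using reach by blast
    with \<open>y \<in> B\<close> show "y \<in> (\<lambda>j. (\<pi> ^^ j) x) ` {j. j < v \<and> d dvd j}"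
      using mem d(2) by blast
  qed (use mem d(2) in auto)
  then have "card B = card {j. j < v \<and> d dvd j}"
    using inj_on_funpow_less[OF xV] by (metis (no_types, lifting) card_image inj_on_subset
        lessThan_iff mem_Collect_eq subsetI)
  then have "k = c" using card_multiples_less[OF d(1), of c] block_card[OF B] c by simp
  then have vd: "v div k = d" and "k dvd v" using c v_pos by auto
  then show "k dvd v" by simp
  show "(\<pi> ^^ (v div k)) ` B = B" using d(2)[of d] vd unfolding S_def by simp
  show "B = {(\<pi> ^^ j) x | j. (v div k) dvd j}"
    unfolding vd using mem d(2) reach by blast
qed

text \<open>The blocks whose orbit under the cycle is shorter than \<open>v\<close>.\<close>
definition short_blocks :: "'a set set" where
  "short_blocks = {B \<in> \<B>. \<exists>m. 0 < m \<and> m < v \<and> (\<pi> ^^ m) ` B = B}"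

text \<open>Short blocks are disjoint, since a short block is determined by any one of its points.\<close>
lemma card_short_blocks: "card short_blocks * k \<le> v"
proof -
  have sub: "short_blocks \<subseteq> \<B>" unfolding short_blocks_def by auto
  have disj: "B \<inter> C = {}" if "B \<in> short_blocks" "C \<in> short_blocks" "B \<noteq> C" for B C
  proof (rule ccontr)
    assume "B \<inter> C \<noteq> {}"
    then obtain x where "x \<in> B" "x \<in> C" by auto
    then have "B = {(\<pi> ^^ j) x | j. (v div k) dvd j}" "C = {(\<pi> ^^ j) x | j. (v div k) dvd j}"
      using that short_block(3) unfolding short_blocks_def by blast+
    with that(3) show False by simp
  qed
  have "(\<Sum>B\<in>short_blocks. card B) = card (\<Union>short_blocks)"
  proof (rule card_Union_disjoint[symmetric])
    show "pairwise disjnt short_blocks" using disj by (auto simp: pairwise_def disjnt_def)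
    show "finite B" if "B \<in> short_blocks" for B
      using that sub block_subset finite_V by (meson finite_subset subsetD)
  qed
  also have "\<dots> \<le> card V" using sub block_subset finite_V by (intro card_mono) auto
  finally show ?thesis using sub block_card card_V by (simp add: subset_iff)
qed

text \<open>
  The two squares are those of the values of the quadratic character at representatives of the
  two full block orbits.
\<close>
lemma double_k_sum_two_squares:
  assumes v: "v = k * (2 * k - 1)" and k: "even k" "k \<ge> 2"
  shows "\<exists>a b :: nat. a\<^sup>2 + b\<^sup>2 = 2 * k"
proof -
  have ev: "even v" using v k by simp
  obtain \<epsilon> :: "'a \<Rightarrow> int" where \<epsilon>: "\<And>x. \<epsilon> x * \<epsilon> x = 1" "\<And>x. x \<in> V \<Longrightarrow> \<epsilon> (\<pi> x) = - \<epsilon> x"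
    using alternating_signs[OF ev] by blast
  note neg = sum_signs_image[of \<epsilon>, OF \<epsilon>(2)]
  have "sum \<epsilon> V = - sum \<epsilon> V"
    using neg[of V 1] permutes_image[OF permutes] by simp
  then have zero: "sum \<epsilon> V = 0" by simp
  have fB: "finite \<B>" using design by (rule steiner_finite_blocks)
  define n where "n = card \<B>"
  have vk: "int v = int k * (2 * int k - 1)" using v k by simp
  have "int (n * (k * (k - 1))) = int (v * (v - 1))"
    using steiner_card_blocks[OF design] unfolding n_def by simp
  then have "int n * (int k * (int k - 1)) = int v * (int v - 1)"
    using k v_pos by simp
  also have "\<dots> = (4 * (int k)\<^sup>2 - 1) * (int k * (int k - 1))"
    unfolding vk by (simp add: power2_eq_square algebra_simps)
  finally have n: "int n = 4 * (int k)\<^sup>2 - 1" using k by simp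
  have "(\<Sum>B\<in>\<B>. (sum \<epsilon> B)\<^sup>2) = int n * int k - int v"
    unfolding n_def using design \<epsilon>(1) zero by (rule steiner_sum_square_signs)
  also have "\<dots> = int v * (2 * int k)"
    unfolding n vk by (simp add: power2_eq_square algebra_simps)
  finally have total: "(\<Sum>B\<in>\<B>. (sum \<epsilon> B)\<^sup>2) = int v * (2 * int k)" .

  have short_zero: "sum \<epsilon> B = 0" if "B \<in> short_blocks" for B
  proof -
    have B: "B \<in> \<B>" using that unfolding short_blocks_def by auto
    then have "B \<noteq> {}" using block_card k by fastforce
    then have "(\<pi> ^^ (v div k)) ` B = B"
      using that short_block(2) unfolding short_blocks_def by blast
    moreover have "odd (v div k)" using v k by simp
    ultimately show ?thesis using neg[of B "v div k"] B block_subset by simp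
  qed

  define G where "G = \<B> - short_blocks"
  define w where "w B = (sum \<epsilon> B)\<^sup>2" for B
  have shB: "short_blocks \<subseteq> \<B>" unfolding short_blocks_def by auto
  have GB: "G \<subseteq> \<B>" unfolding G_def by auto
  have sumG: "sum w G = int v * (2 * int k)"
  proof -
    have "sum w G = sum w \<B>"
      unfolding G_def w_def using fB short_zero by (intro sum.mono_neutral_left) auto
    then show ?thesis using total unfolding w_def by simp
  qed
  have free: "(\<pi> ^^ m) ` B \<noteq> B" if "B \<in> G" "0 < m" "m < v" for B m
    using that unfolding G_def short_blocks_def by auto
  have GT: "\<pi> ` B \<in> G" if "B \<in> G" for B
  proof -
    have False if "0 < m" "m < v" "(\<pi> ^^ m) ` \<pi> ` B = \<pi> ` B" for m
    proof -
      have "\<pi> ` ((\<pi> ^^ m) ` B) = \<pi> ` B"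
        using that(3) by (simp add: image_image funpow_swap1)
      then show False
        using free[OF \<open>B \<in> G\<close> that(1,2)] inj_image_eq_iff[OF permutes_inj[OF permutes]] by auto
    qed
    then show ?thesis using that block_closed unfolding G_def short_blocks_def by auto
  qed
  have "\<exists>xs. set xs \<subseteq> G \<and> card G = v * length xs \<and> sum w G = int v * sum_list (map w xs)"
  proof (rule sum_over_free_orbits[where T = "(`) \<pi>"])
    show "finite G" using fB GB finite_subset by auto
    show "((`) \<pi> ^^ v) B = B" if "B \<in> G" for B
    proof -
      have "B \<subseteq> V" using that GB block_subset by auto
      then have "(\<pi> ^^ v) ` B = id ` B" using funpow_v by (intro image_cong) auto
      then show ?thesis by (simp add: funpow_image)
    qed
    show "w (\<pi> ` B) = w B" if "B \<in> G" for B
      using neg[of B 1] that GB block_subset unfolding w_def by auto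
  qed (use v_pos GT free in \<open>auto simp: funpow_image\<close>)
  then obtain xs where xs: "card G = v * length xs" "sum w G = int v * sum_list (map w xs)"
    by blast

  \<comment> \<open>At most \<open>2 k - 1\<close> of the \<open>4 k\<^sup>2 - 1\<close> blocks are short, which leaves room for two full orbits only.\<close>
  have "card short_blocks \<le> 2 * k - 1"
    using card_short_blocks k unfolding v by (simp add: mult.commute)
  moreover have "int (card G) = int n - int (card short_blocks)"
    unfolding G_def n_def using fB shB
    by (simp add: card_Diff_subset finite_subset card_mono)
  ultimately have lower: "2 * int v \<le> int (card G)" and upper: "int (card G) \<le> 4 * (int k)\<^sup>2 - 1"
    using n k unfolding vk by (auto simp: power2_eq_square algebra_simps)
  have "0 < (2 * int k - 1) * (int k - 1)" using k by simp
  then have "int (card G) < 3 * int v"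
    using upper unfolding vk by (simp add: power2_eq_square algebra_simps)
  with lower have "v * 2 \<le> v * length xs" "v * length xs < v * 3" unfolding xs(1) by linarith+
  then have "length xs = 2" by (simp only: mult_le_cancel1 mult_less_cancel1) simp
  then obtain B C where "xs = [B, C]" by (auto simp: numeral_2_eq_2 length_Suc_conv)
  then have "int v * (2 * int k) = int v * (w B + w C)" using xs(2) sumG by simp
  then have "w B + w C = 2 * int k" using v_pos by simp
  then have "int ((nat \<bar>sum \<epsilon> B\<bar>)\<^sup>2 + (nat \<bar>sum \<epsilon> C\<bar>)\<^sup>2) = int (2 * k)" unfolding w_def by simp
  then show ?thesis using of_nat_eq_iff by blast
qed

end

section \<open>Nonexistence\<close>

theorem theorem5p1:
  fixes k :: nat
  assumes "k > 0" and "even k"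
    and "\<exists>p::nat. prime p \<and> p mod 4 = 3 \<and> odd (multiplicity p k)"
  shows "\<not> (\<exists>(V :: 'a set) \<B>. cyclic_steiner_2_design k (2 * k * (k - 1) + k) V \<B>)"
proof
  assume "\<exists>(V :: 'a set) \<B>. cyclic_steiner_2_design k (2 * k * (k - 1) + k) V \<B>"
  then obtain V :: "'a set" and \<B> \<pi> where
    "steiner_2_design k (2 * k * (k - 1) + k) V \<B>" "\<pi> permutes V" "cyclic_on \<pi> V"
    "\<forall>B\<in>\<B>. \<pi> ` B \<in> \<B>"
    unfolding cyclic_steiner_2_design_def by blast
  then interpret cyclic_design k "2 * k * (k - 1) + k" V \<B> \<pi>
    by unfold_locales auto
  obtain p :: nat where p: "prime p" "p mod 4 = 3" "odd (multiplicity p k)" using assms(3) by blast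
  have "k \<ge> 2" using assms(1,2) by presburger
  moreover from this have "2 * k * (k - 1) + k = k * (2 * k - 1)"
    by (cases k) (auto simp: algebra_simps)
  ultimately obtain a b :: nat where ab: "a\<^sup>2 + b\<^sup>2 = 2 * k"
    using double_k_sum_two_squares assms(2) by blast
  then have "even (multiplicity p (2 * k))"
    using even_multiplicity_sum_two_squares[OF p(1,2), of a b] assms(1) by simp
  moreover have "multiplicity p (2 * k) = multiplicity p k"
  proof -
    have "\<not> p dvd 2" using p(2) primes_dvd_imp_eq[OF p(1) two_is_prime_nat] by auto
    then show ?thesis
      using p(1) assms(1) by (simp add: prime_elem_multiplicity_mult_distrib not_dvd_imp_multiplicity_0)
  qed
  ultimately show False using p(3) by simp
qed

end
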